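(* Let $\mathsf{A}\subset M_{d_1}(\mathbb{R})$ and $\mathsf{B}\subset M_{d_2}(\mathbb{R})$ be nonempty compact sets of matrices with $\varrho(\mathsf{A})=\varrho(\mathsf{B})=1$, let $(a_n)_{n=1}^\infty$ and $(b_n)_{n=1}^\infty$ be their respective marginal instability rate sequences calculated with respect to the Euclidean norm, and let $k\geq 1$ be an integer. Then each of the three sequences $(\max\{a_n,b_n\})_{n=1}^\infty$, $(a_nb_n)_{n=1}^\infty$ and $(a_n^k)_{n=1}^\infty$ is also the marginal instability rate sequence, calculated with respect to the Euclidean norm, of some nonempty compact set of real square matrices (of some dimension). Moreover, if both $\mathsf{A}$ and $\mathsf{B}$ are finite, or both consist only of invertible matrices, or both of these properties hold, then the sets of matrices for which $(\max\{a_n,b_n\})$, $(a_nb_n)$ and $(a_n^k)$ are the marginal instability rate sequences may be chosen to have the same property (respectively: finite; consisting only of invertible matrices; both finite and consisting only of invertible matrices).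
   Context: $M_d(\mathbb{R})$ is the set of $d\times d$ real matrices and $\|\cdot\|$ denotes the Euclidean norm on vectors and the induced operator norm on matrices. For $\mathsf{A}\subset M_d(\mathbb{R})$ and $n\geq 1$, $\mathsf{A}_n:=\{A_1\cdots A_n\colon A_i\in\mathsf{A}\}$. The joint spectral radius of a bounded nonempty set $\mathsf{A}$ is $\varrho(\mathsf{A})=\lim_{n\to\infty}\sup_{A\in\mathsf{A}_n}\|A\|^{1/n}$. If $\mathsf{A}\subset M_d(\mathbb{R})$ is compact and nonempty with $\varrho(\mathsf{A})=1$, the marginal instability rate sequence of $\mathsf{A}$ with respect to the Euclidean norm is the sequence $(a_n)_{n=1}^\infty$ with $a_n=\max_{A\in\mathsf{A}_n}\|A\|$; in particular, saying that a sequence is the marginal instability rate sequence of a set entails that this set has joint spectral radius equal to $1$. *)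

theory Defs
  imports "HOL-Analysis.Analysis" "Jordan_Normal_Form.Matrix"
begin

(* HOL-Analysis also has a type vec, whose dimension is a type; the dimensions here are natural
   numbers, because the conclusion quantifies over them. All matrices and vectors below are those
   of Jordan_Normal_Form.Matrix, which carry no norm or topology. *)

definition euclid_norm :: "real Matrix.vec \<Rightarrow> real" where
  "euclid_norm v = sqrt (scalar_prod v v)"

(* Same form as the library's onorm; the zero vector contributes 0 / 0 = 0. *)
definition op_norm :: "real mat \<Rightarrow> real" where
  "op_norm A = (SUP v\<in>carrier_vec (dim_col A). euclid_norm (A *\<^sub>v v) / euclid_norm v)"

(* A matrix as its family of entries, continued by zero, so that the d x d matrices are embedded
   as R^(d x d) in nat \<times> nat \<Rightarrow> real with its product topology. *)
definition entries :: "real mat \<Rightarrow> nat \<times> nat \<Rightarrow> real" where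
  "entries A = (\<lambda>(i, j). if i < dim_row A \<and> j < dim_col A then A $$ (i, j) else 0)"

definition compact_mats :: "nat \<Rightarrow> real mat set \<Rightarrow> bool" where
  "compact_mats d S \<longleftrightarrow> S \<subseteq> carrier_mat d d \<and> compact (entries ` S)"

definition products :: "nat \<Rightarrow> real mat set \<Rightarrow> nat \<Rightarrow> real mat set" where
  "products d S n = {foldr (*) As (1\<^sub>m d) | As. length As = n \<and> set As \<subseteq> S}"

(* Meaningful for nonempty bounded S, where the limit exists by submultiplicativity. *)
definition joint_spectral_radius :: "nat \<Rightarrow> real mat set \<Rightarrow> real" where
  "joint_spectral_radius d S = lim (\<lambda>n. SUP A\<in>products d S n. root n (op_norm A))"

(* The sequence is indexed from 1; the value a 0 is irrelevant. *)
definition marginal_instability_rate :: "nat \<Rightarrow> real mat set \<Rightarrow> (nat \<Rightarrow> real) \<Rightarrow> bool" where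
  "marginal_instability_rate d S a \<longleftrightarrow>
     d \<ge> 1 \<and> S \<noteq> {} \<and> compact_mats d S \<and> joint_spectral_radius d S = 1 \<and>
     (\<forall>n\<ge>1. a n \<in> op_norm ` products d S n \<and> (\<forall>A\<in>products d S n. op_norm A \<le> a n))"

end

theory Submission
  imports Defs
begin

text \<open>
  The maximum is realised by the direct sums of a matrix from \<open>A\<close> and a matrix from \<open>B\<close>, the
  product by their Kronecker products, and the powers by iterating the latter. Both operations are
  multiplicative and act on each factor independently, so the products of length \<open>n\<close> of the
  combined set are exactly the combinations of a product from \<open>A\<close> with a product from \<open>B\<close>; the
  operator norm of a direct sum is the maximum, and that of a Kronecker product the product, of the
  operator norms. For the joint spectral radius, \<open>root n (a n)\<close> and \<open>root n (b n)\<close> converge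
  by submultiplicativity, necessarily to 1, and hence so do their maximum and their product.
\<close>

unbundle no vec_syntax

section \<open>Euclidean and operator norm\<close>

lemma euclid_norm_sq: "(euclid_norm v)\<^sup>2 = (\<Sum>i<dim_vec v. (v $ i)\<^sup>2)"
  by (simp add: euclid_norm_def scalar_prod_def power2_eq_square sum_nonneg atLeast0LessThan)

lemma euclid_norm_nonneg [simp]: "0 \<le> euclid_norm v"
  by (simp add: euclid_norm_def scalar_prod_def sum_nonneg)

text \<open>Cauchy-Schwarz in each row shows that the Frobenius norm is such a constant. It is what
  makes the supremum in \<open>op_norm\<close> a genuine one.\<close>

lemma euclid_norm_mult_mat_vec_bounded:
  obtains c where "\<And>v. v \<in> carrier_vec (dim_col A) \<Longrightarrow> euclid_norm (A *\<^sub>v v) \<le> c * euclid_norm v"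
proof -
  define c where "c = sqrt (\<Sum>i<dim_row A. \<Sum>j<dim_col A. (A $$ (i, j))\<^sup>2)"
  have "euclid_norm (A *\<^sub>v v) \<le> c * euclid_norm v" if v: "v \<in> carrier_vec (dim_col A)" for v
  proof (rule power2_le_imp_le)
    have "(euclid_norm (A *\<^sub>v v))\<^sup>2 = (\<Sum>i<dim_row A. (\<Sum>j<dim_col A. A $$ (i, j) * v $ j)\<^sup>2)"
      using v by (auto simp: euclid_norm_sq scalar_prod_def atLeast0LessThan
          intro!: sum.cong arg_cong[where f = "\<lambda>x. x\<^sup>2"])
    also have "\<dots> \<le> (\<Sum>i<dim_row A. (\<Sum>j<dim_col A. (A $$ (i, j))\<^sup>2) * (\<Sum>j<dim_col A. (v $ j)\<^sup>2))"
      by (intro sum_mono Cauchy_Schwarz_ineq_sum)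
    also have "\<dots> = (c * euclid_norm v)\<^sup>2"
      using v by (simp add: power_mult_distrib euclid_norm_sq c_def sum_nonneg sum_distrib_right)
    finally show "(euclid_norm (A *\<^sub>v v))\<^sup>2 \<le> (c * euclid_norm v)\<^sup>2" .
    show "0 \<le> c * euclid_norm v"
      by (simp add: c_def sum_nonneg)
  qed
  with that show thesis by blast
qed

lemma op_norm_bdd: "bdd_above ((\<lambda>v. euclid_norm (A *\<^sub>v v) / euclid_norm v) ` carrier_vec (dim_col A))"
proof -
  obtain c where c: "\<And>v. v \<in> carrier_vec (dim_col A) \<Longrightarrow> euclid_norm (A *\<^sub>v v) \<le> c * euclid_norm v"
    using euclid_norm_mult_mat_vec_bounded by blast
  \<comment> \<open>The sign of \<open>c\<close> is unknown, while a vector of norm 0 contributes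
    the quotient 0.\<close>
  have "euclid_norm (A *\<^sub>v v) / euclid_norm v \<le> max c 0" if "v \<in> carrier_vec (dim_col A)" for v
  proof (cases "euclid_norm v = 0")
    case False
    then have "0 < euclid_norm v"
      using euclid_norm_nonneg[of v] by linarith
    with c[OF that] have "euclid_norm (A *\<^sub>v v) / euclid_norm v \<le> c"
      by (simp add: divide_le_eq)
    then show ?thesis by simp
  qed simp
  then show ?thesis
    by (auto simp: bdd_above_def)
qed

lemma op_norm_nonneg [simp]: "0 \<le> op_norm A"
  unfolding op_norm_def
  by (rule cSUP_upper2[OF op_norm_bdd, of "0\<^sub>v (dim_col A)"]) auto

lemma euclid_norm_le_op_norm:
  assumes v: "v \<in> carrier_vec (dim_col A)"
  shows "euclid_norm (A *\<^sub>v v) \<le> op_norm A * euclid_norm v"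
proof (cases "euclid_norm v = 0")
  case True
  \<comment> \<open>A quotient by 0 carries no information about the image of \<open>v\<close>; any
    finite bound forces its norm to vanish.\<close>
  obtain c where "euclid_norm (A *\<^sub>v v) \<le> c * euclid_norm v"
    using euclid_norm_mult_mat_vec_bounded v by blast
  with True show ?thesis by simp
next
  case False
  then have "0 < euclid_norm v"
    using euclid_norm_nonneg[of v] by linarith
  moreover have "euclid_norm (A *\<^sub>v v) / euclid_norm v \<le> op_norm A"
    unfolding op_norm_def by (rule cSUP_upper[OF v op_norm_bdd])
  ultimately show ?thesis by (simp add: divide_le_eq)
qed

lemma op_norm_le:
  assumes "0 \<le> c"
    and c: "\<And>v. v \<in> carrier_vec (dim_col A) \<Longrightarrow> euclid_norm (A *\<^sub>v v) \<le> c * euclid_norm v"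
  shows "op_norm A \<le> c"
  unfolding op_norm_def
proof (rule cSUP_least)
  have "0\<^sub>v (dim_col A) \<in> (carrier_vec (dim_col A) :: real vec set)"
    by simp
  then show "(carrier_vec (dim_col A) :: real vec set) \<noteq> {}"
    by blast
  fix v :: "real vec" assume v: "v \<in> carrier_vec (dim_col A)"
  show "euclid_norm (A *\<^sub>v v) / euclid_norm v \<le> c"
  proof (cases "euclid_norm v = 0")
    case False
    then have "0 < euclid_norm v"
      using euclid_norm_nonneg[of v] by linarith
    with c[OF v] show ?thesis by (simp add: divide_le_eq)
  qed (simp add: \<open>0 \<le> c\<close>)
qed

lemma op_norm_mult:
  assumes "dim_col A = dim_row B"
  shows "op_norm (A * B) \<le> op_norm A * op_norm B"
proof (rule op_norm_le)
  fix v :: "real vec"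
  assume "v \<in> carrier_vec (dim_col (A * B))"
  then have v: "v \<in> carrier_vec (dim_col B)" by simp
  have "A * B *\<^sub>v v = A *\<^sub>v (B *\<^sub>v v)"
    using assms v
    by (intro assoc_mult_mat_vec[of _ "dim_row A" "dim_row B" _ "dim_col B"]) (auto intro: carrier_matI)
  then have "euclid_norm (A * B *\<^sub>v v) = euclid_norm (A *\<^sub>v (B *\<^sub>v v))"
    by (rule arg_cong)
  also have "\<dots> \<le> op_norm A * euclid_norm (B *\<^sub>v v)"
    using assms by (intro euclid_norm_le_op_norm carrier_vecI) simp
  also have "\<dots> \<le> op_norm A * (op_norm B * euclid_norm v)"
    by (intro mult_left_mono euclid_norm_le_op_norm v) simp
  finally show "euclid_norm (A * B *\<^sub>v v) \<le> op_norm A * op_norm B * euclid_norm v"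
    by (simp add: mult.assoc)
qed simp

section \<open>Products and the joint spectral radius\<close>

lemma products_0: "products d S 0 = {1\<^sub>m d}"
  by (auto simp: products_def)

lemma products_Suc: "products d S (Suc n) = {X * P | X P. X \<in> S \<and> P \<in> products d S n}"
proof (intro Set.set_eqI iffI)
  fix M assume "M \<in> products d S (Suc n)"
  then obtain As where "M = foldr (*) As (1\<^sub>m d)" "length As = Suc n" "set As \<subseteq> S"
    by (auto simp: products_def)
  then show "M \<in> {X * P | X P. X \<in> S \<and> P \<in> products d S n}"
    by (cases As) (auto simp: products_def)
next
  fix M assume "M \<in> {X * P | X P. X \<in> S \<and> P \<in> products d S n}"
  then obtain X As where "M = X * foldr (*) As (1\<^sub>m d)" "X \<in> S" "length As = n" "set As \<subseteq> S"
    by (auto simp: products_def)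
  then show "M \<in> products d S (Suc n)"
    by (auto simp: products_def intro!: exI[of _ "X # As"])
qed

lemma products_carrier:
  assumes "S \<subseteq> carrier_mat d d" "P \<in> products d S n"
  shows "P \<in> carrier_mat d d"
  using assms(2)
proof (induction n arbitrary: P)
  case (Suc n)
  then show ?case
    using assms(1) by (auto simp: products_Suc)
qed (simp add: products_0)

text \<open>Reassociation cuts a word after its first \<open>m\<close> letters. This is the source
  of submultiplicativity for the rate sequence.\<close>

lemma products_split:
  assumes S: "S \<subseteq> carrier_mat d d" and "P \<in> products d S (m + n)"
  obtains Q R where "Q \<in> products d S m" "R \<in> products d S n" "P = Q * R"
  using assms(2)
proof (induction m arbitrary: P thesis)
  case 0
  have "P = 1\<^sub>m d * P"
    using products_carrier[OF S, of P n] 0(2) by simp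
  then show ?case
    using 0 by (auto simp: products_0)
next
  case (Suc m)
  then obtain X P' where X: "X \<in> S" "P' \<in> products d S (m + n)" "P = X * P'"
    by (auto simp: products_Suc)
  obtain Q R where Q: "Q \<in> products d S m" "R \<in> products d S n" "P' = Q * R"
    using Suc.IH X(2) by blast
  have "X * Q \<in> products d S (Suc m)"
    using X Q by (auto simp: products_Suc)
  moreover have "P = (X * Q) * R"
    unfolding X(3) Q(3)
    using X(1) S Q(1,2) products_carrier[OF S] by (intro assoc_mult_mat[symmetric]) blast+
  ultimately show ?case
    using Suc.prems(1) Q(2) by blast
qed

text \<open>Fekete's argument: a bound \<open>u m \<le> c ^ m\<close> at one index propagates to
  \<open>u n \<le> K * c ^ n\<close> at all indices.\<close>

lemma convergent_root_submult:
  fixes u :: "nat \<Rightarrow> real"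
  assumes nonneg: "\<And>n. n \<ge> 1 \<Longrightarrow> 0 \<le> u n"
    and submult: "\<And>m n. m \<ge> 1 \<Longrightarrow> n \<ge> 1 \<Longrightarrow> u (m + n) \<le> u m * u n"
  shows "convergent (\<lambda>n. root n (u n))"
proof -
  \<comment> \<open>The limit will be this infimum. It bounds every term from below, so only the
    upper estimate needs submultiplicativity.\<close>
  define L where "L = (INF n\<in>{1..}. root n (u n))"
  have bdd: "bdd_below ((\<lambda>n. root n (u n)) ` {1..})"
    using nonneg by (auto intro!: bdd_belowI[of _ 0])
  have L_le: "L \<le> root n (u n)" if "n \<ge> 1" for n
    unfolding L_def using bdd that by (intro cINF_lower) auto
  have L_nonneg: "0 \<le> L"
    unfolding L_def using nonneg by (intro cINF_greatest) auto
  have "(\<lambda>n. root n (u n)) \<longlonglongrightarrow> L"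
  proof (rule order_tendstoI)
    fix x assume "x < L"
    then show "\<forall>\<^sub>F n in sequentially. x < root n (u n)"
      using L_le by (intro eventually_sequentiallyI[of 1]) force
  next
    fix x assume "L < x"
    then obtain c where c: "L < c" "c < x"
      using dense by blast
    obtain m where m: "m \<ge> 1" "root m (u m) < c"
      using c(1) bdd unfolding L_def by (subst (asm) cINF_less_iff) auto
    have c0: "c > 0"
      using c(1) L_nonneg by simp
    have um: "u m \<le> c ^ m"
      using m nonneg[OF m(1)] real_root_pow_pos2[of m "u m"]
      by (metis less_imp_le power_mono real_root_ge_zero One_nat_def Suc_le_eq)
    \<comment> \<open>The sum dominates \<open>u r / c ^ r\<close> for each \<open>r\<close> up to
      \<open>m\<close>, the base of the induction that peels off blocks of length \<open>m\<close>;
      the summand 1 makes \<open>K\<close> positive, so that \<open>root n K\<close> tends to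
      1.\<close>
    define K where "K = 1 + (\<Sum>r\<in>{1..m}. u r / c ^ r)"
    have K0: "K > 0"
      unfolding K_def using nonneg c0 by (intro add_pos_nonneg sum_nonneg) auto
    have K: "u n \<le> K * c ^ n" if "n \<ge> 1" for n
      using that
    proof (induction n rule: less_induct)
      case (less n)
      show ?case
      proof (cases "n \<le> m")
        case True
        have "u n / c ^ n \<le> (\<Sum>r\<in>{1..m}. u r / c ^ r)"
          using True less.prems nonneg c0 by (intro member_le_sum) auto
        then have "u n / c ^ n \<le> K" by (simp add: K_def)
        then show ?thesis using c0 by (simp add: divide_le_eq)
      next
        case False
        have "u n \<le> u m * u (n - m)"
          using submult[of m "n - m"] m False by simp
        also have "\<dots> \<le> c ^ m * (K * c ^ (n - m))"
          using less.IH[of "n - m"] um False m nonneg c0 by (intro mult_mono) auto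
        also have "\<dots> = K * c ^ n"
          using False by (simp add: power_add[symmetric])
        finally show ?thesis .
      qed
    qed
    have "(\<lambda>n. root n K * c) \<longlonglongrightarrow> 1 * c"
      by (intro tendsto_mult LIMSEQ_root_const K0) simp
    then have "\<forall>\<^sub>F n in sequentially. root n K * c < x"
      using c(2) by (intro order_tendstoD) auto
    moreover have "\<forall>\<^sub>F n in sequentially. root n (u n) \<le> root n K * c"
    proof (rule eventually_sequentiallyI[of 1])
      fix n :: nat assume n: "1 \<le> n"
      have "root n (u n) \<le> root n (K * c ^ n)"
        using n K by simp
      also have "\<dots> = root n K * c"
        using n c0 by (simp add: real_root_mult real_root_power_cancel)
      finally show "root n (u n) \<le> root n K * c" .
    qed
    ultimately show "\<forall>\<^sub>F n in sequentially. root n (u n) < x"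
      by eventually_elim simp
  qed
  then show ?thesis by (auto simp: convergent_def)
qed

text \<open>Roots are monotone, so the supremum is attained where the norm is maximal. At
  \<open>n = 0\<close> both sides are 0 because \<open>root 0\<close> is constantly 0.\<close>

lemma joint_spectral_radius_eq_lim:
  assumes max: "\<And>n. n \<ge> 1 \<Longrightarrow>
      a n \<in> op_norm ` products d S n \<and> (\<forall>P\<in>products d S n. op_norm P \<le> a n)"
  shows "joint_spectral_radius d S = lim (\<lambda>n. root n (a n))"
proof -
  have "(SUP P\<in>products d S n. root n (op_norm P)) = root n (a n)" for n
  proof (cases "n = 0")
    case False
    with max[of n] show ?thesis
      by (intro cSup_eq_maximum) auto
  qed (simp add: products_0)
  then show ?thesis by (simp add: joint_spectral_radius_def)
qed

text \<open>Convergence has to be established separately, since \<^const>\<open>lim\<close> is a junk value for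
  divergent sequences.\<close>

lemma marginal_instability_rate_root_tendsto:
  assumes "marginal_instability_rate d S a"
  shows "(\<lambda>n. root n (a n)) \<longlonglongrightarrow> 1"
proof -
  have S: "S \<subseteq> carrier_mat d d"
    and max: "\<And>n. n \<ge> 1 \<Longrightarrow>
      a n \<in> op_norm ` products d S n \<and> (\<forall>P\<in>products d S n. op_norm P \<le> a n)"
    using assms by (auto simp: marginal_instability_rate_def compact_mats_def)
  have nonneg: "0 \<le> a n" if "n \<ge> 1" for n
    using max[OF that] by auto
  have "convergent (\<lambda>n. root n (a n))"
  proof (rule convergent_root_submult)
    fix m n :: nat assume mn: "m \<ge> 1" "n \<ge> 1"
    \<comment> \<open>A maximiser of length \<open>m + n\<close> splits into words of lengths
      \<open>m\<close> and \<open>n\<close>, whose norms are bounded by \<open>a m\<close> and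
      \<open>a n\<close>.\<close>
    obtain P where P: "P \<in> products d S (m + n)" "a (m + n) = op_norm P"
      using max[of "m + n"] mn by auto
    obtain Q R where QR: "Q \<in> products d S m" "R \<in> products d S n" "P = Q * R"
      using products_split[OF S P(1)] .
    have "Q \<in> carrier_mat d d" "R \<in> carrier_mat d d"
      using QR products_carrier[OF S] by blast+
    then have "op_norm P \<le> op_norm Q * op_norm R"
      unfolding QR by (intro op_norm_mult) auto
    also have "\<dots> \<le> a m * a n"
      using QR max mn nonneg by (intro mult_mono) auto
    finally show "a (m + n) \<le> a m * a n" using P by simp
  qed (rule nonneg)
  moreover have "lim (\<lambda>n. root n (a n)) = 1"
    using joint_spectral_radius_eq_lim[OF max] assms by (simp add: marginal_instability_rate_def)
  ultimately show ?thesis by (simp add: convergent_LIMSEQ_iff)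
qed

section \<open>Combining two sets of matrices\<close>

text \<open>Common interface of direct sums and Kronecker products: \<open>f\<close> combines
  matrices, \<open>g\<close> is the same operation on entry families, and \<open>N\<close> is its
  effect on operator norms. Compactness rests on continuity of \<open>g\<close>; \<open>mono\<close>
  turns maxima into maxima, while \<open>root\<close> and \<open>tendsto\<close> transfer the joint
  spectral radius.\<close>

locale matrix_pairing =
  fixes d1 d2 d :: nat
    and f :: "real mat \<Rightarrow> real mat \<Rightarrow> real mat"
    and g :: "(nat \<times> nat \<Rightarrow> real) \<Rightarrow> (nat \<times> nat \<Rightarrow> real) \<Rightarrow> nat \<times> nat \<Rightarrow> real"
    and N :: "real \<Rightarrow> real \<Rightarrow> real"
  assumes dim_pos: "d1 \<ge> 1 \<Longrightarrow> d2 \<ge> 1 \<Longrightarrow> d \<ge> 1"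
    and carrier: "X \<in> carrier_mat d1 d1 \<Longrightarrow> Y \<in> carrier_mat d2 d2 \<Longrightarrow> f X Y \<in> carrier_mat d d"
    and mult: "X \<in> carrier_mat d1 d1 \<Longrightarrow> X' \<in> carrier_mat d1 d1 \<Longrightarrow>
      Y \<in> carrier_mat d2 d2 \<Longrightarrow> Y' \<in> carrier_mat d2 d2 \<Longrightarrow>
      f X Y * f X' Y' = f (X * X') (Y * Y')"
    and one: "f (1\<^sub>m d1) (1\<^sub>m d2) = 1\<^sub>m d"
    and op_norm: "X \<in> carrier_mat d1 d1 \<Longrightarrow> Y \<in> carrier_mat d2 d2 \<Longrightarrow>
      op_norm (f X Y) = N (op_norm X) (op_norm Y)"
    and entries: "X \<in> carrier_mat d1 d1 \<Longrightarrow> Y \<in> carrier_mat d2 d2 \<Longrightarrow>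
      entries (f X Y) = g (entries X) (entries Y)"
    and continuous: "\<And>p. continuous_on UNIV (\<lambda>z. g (fst z) (snd z) p)"
    and mono: "0 \<le> x \<Longrightarrow> x \<le> x' \<Longrightarrow> 0 \<le> y \<Longrightarrow> y \<le> y' \<Longrightarrow> N x y \<le> N x' y'"
    and root: "0 \<le> x \<Longrightarrow> 0 \<le> y \<Longrightarrow> n \<ge> 1 \<Longrightarrow> root n (N x y) = N (root n x) (root n y)"
    and tendsto: "u \<longlonglongrightarrow> 1 \<Longrightarrow> v \<longlonglongrightarrow> 1 \<Longrightarrow> (\<lambda>n. N (u n) (v n)) \<longlonglongrightarrow> 1"
begin

definition pair_set :: "real mat set \<Rightarrow> real mat set \<Rightarrow> real mat set" where
  "pair_set A B = (\<lambda>(X, Y). f X Y) ` (A \<times> B)"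

text \<open>The letters from \<open>A\<close> and \<open>B\<close> are chosen independently, so two
  words of equal length can be zipped into one word of pairs, and \<open>mult\<close> separates them
  again.\<close>

lemma products_pair_set:
  assumes A: "A \<subseteq> carrier_mat d1 d1" and B: "B \<subseteq> carrier_mat d2 d2"
  shows "products d (pair_set A B) n = pair_set (products d1 A n) (products d2 B n)"
proof (induction n)
  case 0
  then show ?case by (simp add: products_0 pair_set_def one)
next
  case (Suc n)
  have eq: "f X Y * f P Q = f (X * P) (Y * Q)"
    if "X \<in> A" "Y \<in> B" "P \<in> products d1 A n" "Q \<in> products d2 B n" for X Y P Q
    using that A B products_carrier[OF A] products_carrier[OF B] by (intro mult) auto
  show ?case
  proof (intro Set.set_eqI iffI)
    fix M assume "M \<in> products d (pair_set A B) (Suc n)"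
    then obtain X Y P Q where *: "X \<in> A" "Y \<in> B" "P \<in> products d1 A n" "Q \<in> products d2 B n"
      "M = f X Y * f P Q"
      unfolding products_Suc Suc.IH by (auto simp: pair_set_def)
    then show "M \<in> pair_set (products d1 A (Suc n)) (products d2 B (Suc n))"
      using eq[OF *(1-4)] by (force simp: products_Suc pair_set_def)
  next
    fix M assume "M \<in> pair_set (products d1 A (Suc n)) (products d2 B (Suc n))"
    then obtain X Y P Q where *: "X \<in> A" "Y \<in> B" "P \<in> products d1 A n" "Q \<in> products d2 B n"
      "M = f (X * P) (Y * Q)"
      by (auto simp: products_Suc pair_set_def)
    then have "M = f X Y * f P Q" by (simp add: eq)
    with * show "M \<in> products d (pair_set A B) (Suc n)"
      unfolding products_Suc Suc.IH by (force simp: pair_set_def)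
  qed
qed

text \<open>The entry families form the image of a product of compact sets under \<open>g\<close>,
  whose continuity into the product topology is checked coordinatewise.\<close>

lemma compact_mats_pair_set:
  assumes "compact_mats d1 A" "compact_mats d2 B"
  shows "compact_mats d (pair_set A B)"
proof -
  have A: "A \<subseteq> carrier_mat d1 d1" and B: "B \<subseteq> carrier_mat d2 d2"
    using assms by (auto simp: compact_mats_def)
  have "entries ` pair_set A B = (\<lambda>z. g (fst z) (snd z)) ` (entries ` A \<times> entries ` B)"
  proof -
    have "entries ` pair_set A B = (\<lambda>(X, Y). g (entries X) (entries Y)) ` (A \<times> B)"
      unfolding pair_set_def image_image by (intro image_cong)
        (auto simp: entries subsetD[OF A] subsetD[OF B])
    also have "\<dots> = (\<lambda>z. g (fst z) (snd z)) ` (entries ` A \<times> entries ` B)"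
      by force
    finally show ?thesis .
  qed
  moreover have "compact \<dots>"
    using assms unfolding compact_mats_def
    by (intro compact_continuous_image compact_Times continuous_on_coordinatewise_then_product
        continuous_on_subset[OF continuous]) auto
  ultimately show ?thesis
    using A B by (auto simp: compact_mats_def pair_set_def intro!: carrier)
qed

lemma marginal_instability_rate_pair_set:
  assumes a: "marginal_instability_rate d1 A a" and b: "marginal_instability_rate d2 B b"
  shows "marginal_instability_rate d (pair_set A B) (\<lambda>n. N (a n) (b n))"
proof -
  note defs = marginal_instability_rate_def compact_mats_def
  have A: "A \<subseteq> carrier_mat d1 d1" and B: "B \<subseteq> carrier_mat d2 d2"
    using a b by (auto simp: defs)
  have max: "N (a n) (b n) \<in> op_norm ` products d (pair_set A B) n \<and>
      (\<forall>P\<in>products d (pair_set A B) n. op_norm P \<le> N (a n) (b n))" if n: "n \<ge> 1" for n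
  proof -
    have norm: "op_norm (f P Q) = N (op_norm P) (op_norm Q)"
      if "P \<in> products d1 A n" "Q \<in> products d2 B n" for P Q
      using that products_carrier[OF A] products_carrier[OF B] by (intro op_norm) auto
    \<comment> \<open>Separate maximisers for \<open>A\<close> and \<open>B\<close> combine into a
      single product, so the upper bound given by \<open>mono\<close> is attained.\<close>
    obtain P Q where PQ: "P \<in> products d1 A n" "Q \<in> products d2 B n"
      "a n = op_norm P" "b n = op_norm Q"
      using a b n unfolding marginal_instability_rate_def by blast
    then have "N (a n) (b n) = op_norm (f P Q)"
      by (simp add: norm)
    moreover have "f P Q \<in> products d (pair_set A B) n"
      unfolding products_pair_set[OF A B] using PQ by (force simp: pair_set_def)
    moreover have "op_norm P' \<le> N (a n) (b n)" if P': "P' \<in> products d (pair_set A B) n" for P'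
    proof -
      obtain U V where UV: "U \<in> products d1 A n" "V \<in> products d2 B n" "P' = f U V"
        using P' unfolding products_pair_set[OF A B] by (auto simp: pair_set_def)
      then show ?thesis
        using a b n by (auto simp: norm marginal_instability_rate_def intro!: mono)
    qed
    ultimately show ?thesis by blast
  qed
  have "(\<lambda>n. N (root n (a n)) (root n (b n))) \<longlonglongrightarrow> 1"
    using a b by (intro tendsto marginal_instability_rate_root_tendsto)
  \<comment> \<open>Only positive \<open>n\<close> are considered: \<open>a 0\<close> and
    \<open>b 0\<close> are arbitrary, and \<open>root\<close> is stated for positive
    exponents.\<close>
  moreover have "\<forall>\<^sub>F n in sequentially. N (root n (a n)) (root n (b n)) = root n (N (a n) (b n))"
  proof (rule eventually_sequentiallyI[of 1])
    fix n :: nat assume n: "1 \<le> n"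
    then have "0 \<le> a n" "0 \<le> b n"
      using a b by (auto simp: marginal_instability_rate_def)
    then show "N (root n (a n)) (root n (b n)) = root n (N (a n) (b n))"
      using root n by simp
  qed
  ultimately have "(\<lambda>n. root n (N (a n) (b n))) \<longlonglongrightarrow> 1"
    by (rule Lim_transform_eventually)
  then have "joint_spectral_radius d (pair_set A B) = 1"
    using joint_spectral_radius_eq_lim[of "\<lambda>n. N (a n) (b n)", OF max] by (simp add: limI)
  moreover have "compact_mats d (pair_set A B)"
    using a b by (auto simp: marginal_instability_rate_def intro!: compact_mats_pair_set)
  ultimately show ?thesis
    using max a b dim_pos by (auto simp: marginal_instability_rate_def pair_set_def)
qed

text \<open>Combining the two inverses gives the inverse of the combination, by \<open>mult\<close>
  and \<open>one\<close>.\<close>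

lemma invertible_pairing:
  assumes X: "X \<in> carrier_mat d1 d1" "invertible_mat X"
    and Y: "Y \<in> carrier_mat d2 d2" "invertible_mat Y"
  shows "invertible_mat (f X Y)"
proof -
  \<comment> \<open>\<open>invertible_mat\<close> does not record the dimensions of the inverse;
    they are recovered by comparing column counts in the two identities.\<close>
  have inverse: "\<exists>M'\<in>carrier_mat n n. M * M' = 1\<^sub>m n \<and> M' * M = 1\<^sub>m n"
    if M: "M \<in> carrier_mat n n" "invertible_mat M" for n and M :: "real mat"
  proof -
    obtain M' where M': "M * M' = 1\<^sub>m n" "M' * M = 1\<^sub>m (dim_row M')"
      using M(2) carrier_matD(1)[OF M(1)] unfolding invertible_mat_def inverts_mat_def by auto
    have "dim_col M' = n"
      using arg_cong[OF M'(1), of dim_col] by simp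
    moreover have "dim_row M' = n"
      using arg_cong[OF M'(2), of dim_col] M(1) by simp
    ultimately show ?thesis
      using M' by (intro bexI[of _ M']) auto
  qed
  obtain X' where X': "X' \<in> carrier_mat d1 d1" "X * X' = 1\<^sub>m d1" "X' * X = 1\<^sub>m d1"
    using inverse[OF X] by blast
  obtain Y' where Y': "Y' \<in> carrier_mat d2 d2" "Y * Y' = 1\<^sub>m d2" "Y' * Y = 1\<^sub>m d2"
    using inverse[OF Y] by blast
  have "f X Y * f X' Y' = 1\<^sub>m d" "f X' Y' * f X Y = 1\<^sub>m d"
    using X Y X' Y' by (simp_all add: mult one)
  moreover have "f X Y \<in> carrier_mat d d" "f X' Y' \<in> carrier_mat d d"
    using X Y X' Y' carrier by auto
  ultimately show ?thesis
    by (auto simp: invertible_mat_def inverts_mat_def intro!: exI[of _ "f X' Y'"])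
qed

text \<open>One witness satisfies both implications simultaneously, which also covers the case of
  sets that are finite and consist of invertible matrices.\<close>

lemma ex_pairing:
  assumes a: "marginal_instability_rate d1 A a" and b: "marginal_instability_rate d2 B b"
  shows "\<exists>d C. marginal_instability_rate d C (\<lambda>n. N (a n) (b n)) \<and>
    (finite A \<and> finite B \<longrightarrow> finite C) \<and>
    ((\<forall>M\<in>A. invertible_mat M) \<and> (\<forall>M\<in>B. invertible_mat M) \<longrightarrow> (\<forall>M\<in>C. invertible_mat M))"
proof (intro exI conjI)
  show "marginal_instability_rate d (pair_set A B) (\<lambda>n. N (a n) (b n))"
    using a b by (rule marginal_instability_rate_pair_set)
  have "A \<subseteq> carrier_mat d1 d1" "B \<subseteq> carrier_mat d2 d2"
    using a b by (auto simp: marginal_instability_rate_def compact_mats_def)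
  then show "(\<forall>M\<in>A. invertible_mat M) \<and> (\<forall>M\<in>B. invertible_mat M) \<longrightarrow>
      (\<forall>M\<in>pair_set A B. invertible_mat M)"
    by (auto simp: pair_set_def intro!: invertible_pairing)
qed (simp add: pair_set_def)

end

section \<open>Direct sums\<close>

definition direct_sum_mat :: "real mat \<Rightarrow> real mat \<Rightarrow> real mat" where
  "direct_sum_mat A B =
     four_block_mat A (0\<^sub>m (dim_row A) (dim_col B)) (0\<^sub>m (dim_row B) (dim_col A)) B"

lemma euclid_norm_append_sq:
  "(euclid_norm (v @\<^sub>v w))\<^sup>2 = (euclid_norm v)\<^sup>2 + (euclid_norm w)\<^sup>2"
proof -
  have "(\<Sum>i<dim_vec v + dim_vec w. ((v @\<^sub>v w) $ i)\<^sup>2)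
      = (\<Sum>i<dim_vec v. ((v @\<^sub>v w) $ i)\<^sup>2) + (\<Sum>i<dim_vec w. ((v @\<^sub>v w) $ (dim_vec v + i))\<^sup>2)"
    using sum.atLeastLessThan_concat[of 0 "dim_vec v" "dim_vec v + dim_vec w" "\<lambda>i. ((v @\<^sub>v w) $ i)\<^sup>2"]
      sum.shift_bounds_nat_ivl[of "\<lambda>i. ((v @\<^sub>v w) $ i)\<^sup>2" 0 "dim_vec v" "dim_vec w"]
    by (simp add: atLeast0LessThan add.commute)
  then show ?thesis
    by (simp add: euclid_norm_sq)
qed

lemma direct_sum_mat_mult_append:
  assumes "v \<in> carrier_vec (dim_col A)" "w \<in> carrier_vec (dim_col B)"
  shows "direct_sum_mat A B *\<^sub>v (v @\<^sub>v w) = (A *\<^sub>v v) @\<^sub>v (B *\<^sub>v w)"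
  unfolding direct_sum_mat_def using assms
  by (subst four_block_mat_mult_vec[of _ "dim_row A" "dim_col A" _ "dim_col B" _ "dim_row B"])
    (auto intro: carrier_vecI)

text \<open>The two blocks act on orthogonal subspaces, so squared norms add. This gives the upper
  bound; vectors supported in one block give the lower one.\<close>

lemma op_norm_direct_sum_mat:
  "op_norm (direct_sum_mat A B) = max (op_norm A) (op_norm B)"
proof (rule antisym)
  let ?m = "max (op_norm A) (op_norm B)"
  have dim: "dim_col (direct_sum_mat A B) = dim_col A + dim_col B"
    by (simp add: direct_sum_mat_def)
  show "op_norm (direct_sum_mat A B) \<le> ?m"
  proof (rule op_norm_le)
    fix x :: "real vec" assume "x \<in> carrier_vec (dim_col (direct_sum_mat A B))"
    then obtain v w where x: "x = v @\<^sub>v w"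
      and v: "v \<in> carrier_vec (dim_col A)" and w: "w \<in> carrier_vec (dim_col B)"
      unfolding dim by (metis vec_first_last_append vec_first_carrier vec_last_carrier)
    have "euclid_norm (A *\<^sub>v v) \<le> ?m * euclid_norm v"
      by (rule order_trans[OF euclid_norm_le_op_norm[OF v]]) (simp add: mult_right_mono)
    moreover have "euclid_norm (B *\<^sub>v w) \<le> ?m * euclid_norm w"
      by (rule order_trans[OF euclid_norm_le_op_norm[OF w]]) (simp add: mult_right_mono)
    ultimately have "(euclid_norm (A *\<^sub>v v))\<^sup>2 + (euclid_norm (B *\<^sub>v w))\<^sup>2
        \<le> (?m * euclid_norm v)\<^sup>2 + (?m * euclid_norm w)\<^sup>2"
      by (intro add_mono power_mono) auto
    then have "(euclid_norm (direct_sum_mat A B *\<^sub>v x))\<^sup>2 \<le> (?m * euclid_norm x)\<^sup>2"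
      by (simp add: x direct_sum_mat_mult_append[OF v w] euclid_norm_append_sq
          power_mult_distrib distrib_left)
    then show "euclid_norm (direct_sum_mat A B *\<^sub>v x) \<le> ?m * euclid_norm x"
      by (rule power2_le_imp_le) (simp add: le_max_iff_disj)
  qed (simp add: le_max_iff_disj)
  let ?n = "op_norm (direct_sum_mat A B)"
  have bound: "(euclid_norm (A *\<^sub>v v))\<^sup>2 + (euclid_norm (B *\<^sub>v w))\<^sup>2
      \<le> ?n\<^sup>2 * ((euclid_norm v)\<^sup>2 + (euclid_norm w)\<^sup>2)"
    if v: "v \<in> carrier_vec (dim_col A)" and w: "w \<in> carrier_vec (dim_col B)" for v w
  proof -
    have "euclid_norm (direct_sum_mat A B *\<^sub>v (v @\<^sub>v w)) \<le> ?n * euclid_norm (v @\<^sub>v w)"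
      using v w by (intro euclid_norm_le_op_norm) (simp add: dim)
    then have "(euclid_norm (direct_sum_mat A B *\<^sub>v (v @\<^sub>v w)))\<^sup>2 \<le> (?n * euclid_norm (v @\<^sub>v w))\<^sup>2"
      by (intro power_mono) auto
    then show ?thesis
      by (simp add: direct_sum_mat_mult_append[OF v w] euclid_norm_append_sq power_mult_distrib)
  qed
  have zero: "(euclid_norm (0\<^sub>v n))\<^sup>2 = 0" for n
    by (simp add: euclid_norm_sq)
  have "op_norm A \<le> ?n"
  proof (rule op_norm_le)
    fix v :: "real vec" assume "v \<in> carrier_vec (dim_col A)"
    then have "(euclid_norm (A *\<^sub>v v))\<^sup>2 \<le> (?n * euclid_norm v)\<^sup>2"
      using bound[of v "0\<^sub>v (dim_col B)"] zero by (simp add: power_mult_distrib) (smt (verit) zero_le_power2)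
    then show "euclid_norm (A *\<^sub>v v) \<le> ?n * euclid_norm v"
      by (rule power2_le_imp_le) simp
  qed simp
  moreover have "op_norm B \<le> ?n"
  proof (rule op_norm_le)
    fix v :: "real vec" assume "v \<in> carrier_vec (dim_col B)"
    then have "(euclid_norm (B *\<^sub>v v))\<^sup>2 \<le> (?n * euclid_norm v)\<^sup>2"
      using bound[of "0\<^sub>v (dim_col A)" v] zero by (simp add: power_mult_distrib) (smt (verit) zero_le_power2)
    then show "euclid_norm (B *\<^sub>v v) \<le> ?n * euclid_norm v"
      by (rule power2_le_imp_le) simp
  qed simp
  ultimately show "?m \<le> ?n" by simp
qed

lemma continuous_on_fst_snd_apply:
  fixes S :: "(('a \<Rightarrow> 'b :: topological_space) \<times> ('c \<Rightarrow> 'd :: topological_space)) set"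
  shows "continuous_on S (\<lambda>z. fst z p)" "continuous_on S (\<lambda>z. snd z q)"
  by (rule continuous_on_product_then_coordinatewise, intro continuous_intros)+

text \<open>Only the size of the first block enters as a parameter: entry families already vanish
  beyond the second block.\<close>

definition direct_sum_entries ::
  "nat \<Rightarrow> (nat \<times> nat \<Rightarrow> real) \<Rightarrow> (nat \<times> nat \<Rightarrow> real) \<Rightarrow> nat \<times> nat \<Rightarrow> real" where
  "direct_sum_entries d x y = (\<lambda>(i, j).
     if i < d \<and> j < d then x (i, j) else if d \<le> i \<and> d \<le> j then y (i - d, j - d) else 0)"

lemma matrix_pairing_direct_sum:
  "matrix_pairing d1 d2 (d1 + d2) direct_sum_mat (direct_sum_entries d1) max"
proof
  fix X Y :: "real mat" assume X: "X \<in> carrier_mat d1 d1" and Y: "Y \<in> carrier_mat d2 d2"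
  then show "direct_sum_mat X Y \<in> carrier_mat (d1 + d2) (d1 + d2)"
    by (simp add: direct_sum_mat_def)
  show "entries (direct_sum_mat X Y) = direct_sum_entries d1 (entries X) (entries Y)"
    using X Y by (auto simp: entries_def direct_sum_mat_def direct_sum_entries_def fun_eq_iff)
  fix X' Y' :: "real mat" assume "X' \<in> carrier_mat d1 d1" "Y' \<in> carrier_mat d2 d2"
  with X Y show "direct_sum_mat X Y * direct_sum_mat X' Y' = direct_sum_mat (X * X') (Y * Y')"
    unfolding direct_sum_mat_def
    by (subst mult_four_block_mat[of _ d1 d1 _ d2 _ d2 _ _ d1 _ d2]) auto
next
  fix p :: "nat \<times> nat"
  show "continuous_on UNIV (\<lambda>z. direct_sum_entries d1 (fst z) (snd z) p)"
    \<comment> \<open>The case distinction depends on the fixed position \<open>p\<close> alone, so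
      the map is a coordinate projection or constantly 0.\<close>
    by (cases "fst p < d1 \<and> snd p < d1"; cases "d1 \<le> fst p \<and> d1 \<le> snd p")
      (auto simp: direct_sum_entries_def split_beta continuous_on_fst_snd_apply)
next
  fix x y :: real and n :: nat assume "1 \<le> n"
  then show "root n (max x y) = max (root n x) (root n y)"
    by (auto simp: max_def)
next
  fix u v :: "nat \<Rightarrow> real" assume "u \<longlonglongrightarrow> 1" "v \<longlonglongrightarrow> 1"
  then show "(\<lambda>n. max (u n) (v n)) \<longlonglongrightarrow> 1"
    using tendsto_max[of u 1 sequentially v 1] by simp
next
  show "direct_sum_mat (1\<^sub>m d1) (1\<^sub>m d2) = 1\<^sub>m (d1 + d2)"
    by (simp add: direct_sum_mat_def)
qed (auto simp: op_norm_direct_sum_mat)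

section \<open>Kronecker products\<close>

definition kron_mat :: "real mat \<Rightarrow> real mat \<Rightarrow> real mat" where
  "kron_mat A B = mat (dim_row A * dim_row B) (dim_col A * dim_col B)
     (\<lambda>(i, j). A $$ (i div dim_row B, j div dim_col B) * B $$ (i mod dim_row B, j mod dim_col B))"

section \<open>Index arithmetic: pairs of indices as quotient and remainder\<close>

lemma div_mod_less:
  assumes "i < m * (n :: nat)"
  shows "i div n < m" "i mod n < n"
  using assms by (auto simp: less_mult_imp_div_less intro!: mod_less_divisor gr0I)

lemma mult_add_less:
  assumes "i < m" "j < (n :: nat)"
  shows "i * n + j < m * n"
proof -
  have "i * n + j < Suc i * n" using assms by simp
  also have "\<dots> \<le> m * n" using assms by (intro mult_right_mono) auto
  finally show ?thesis .
qed

text \<open>Division with remainder is a bijection from the indices below \<open>m * n\<close> to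
  pairs. All sums over Kronecker indices become double sums this way.\<close>

lemma sum_div_mod:
  fixes h :: "nat \<Rightarrow> nat \<Rightarrow> 'a :: comm_monoid_add"
  shows "(\<Sum>k<m * n. h (k div n) (k mod n)) = (\<Sum>i<m. \<Sum>j<n. h i j)"
  unfolding sum.cartesian_product
  by (rule sum.reindex_bij_witness[of _ "\<lambda>(i, j). i * n + j" "\<lambda>k. (k div n, k mod n)"])
    (auto simp: div_mod_less mult_add_less)

section \<open>Operator norm of a Kronecker product\<close>

lemma kron_mat_mult_vec_index:
  assumes v: "v \<in> carrier_vec (dim_col A * dim_col B)" and i: "i < dim_row A * dim_row B"
  shows "(kron_mat A B *\<^sub>v v) $ i = (\<Sum>k<dim_col A. A $$ (i div dim_row B, k) *
      (\<Sum>l<dim_col B. B $$ (i mod dim_row B, l) * v $ (k * dim_col B + l)))"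
proof -
  \<comment> \<open>The index of \<open>v\<close> is expanded into quotient and remainder so that
    the summand has the shape required by \<open>sum_div_mod\<close>.\<close>
  have "(kron_mat A B *\<^sub>v v) $ i = (\<Sum>j<dim_col A * dim_col B.
      A $$ (i div dim_row B, j div dim_col B) * (B $$ (i mod dim_row B, j mod dim_col B) *
      v $ (j div dim_col B * dim_col B + j mod dim_col B)))"
    using v i by (simp add: kron_mat_def scalar_prod_def atLeast0LessThan mult.assoc)
  also have "\<dots> = (\<Sum>k<dim_col A. \<Sum>l<dim_col B.
      A $$ (i div dim_row B, k) * (B $$ (i mod dim_row B, l) * v $ (k * dim_col B + l)))"
    by (rule sum_div_mod)
  finally show ?thesis by (simp add: sum_distrib_left)
qed

text \<open>Coordinate form of the norm bound, applicable to rows and columns of a vector reshaped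
  as a rectangular array.\<close>

lemma op_norm_mult_vec_sq_le:
  "(\<Sum>i<dim_row A. (\<Sum>k<dim_col A. A $$ (i, k) * x k)\<^sup>2)
     \<le> (op_norm A)\<^sup>2 * (\<Sum>k<dim_col A. (x k)\<^sup>2)"
proof -
  let ?v = "vec (dim_col A) x"
  have "(euclid_norm (A *\<^sub>v ?v))\<^sup>2 \<le> (op_norm A * euclid_norm ?v)\<^sup>2"
    by (intro power_mono euclid_norm_le_op_norm) auto
  then show ?thesis
    by (simp add: euclid_norm_sq power_mult_distrib scalar_prod_def atLeast0LessThan)
qed

text \<open>With \<open>v\<close> read as an array, the Kronecker product applies \<open>B\<close>
  along each row and then \<open>A\<close> along each column; each pass costs one operator
  norm.\<close>

lemma op_norm_kron_mat_le: "op_norm (kron_mat A B) \<le> op_norm A * op_norm B"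
proof (rule op_norm_le)
  fix v :: "real vec" assume "v \<in> carrier_vec (dim_col (kron_mat A B))"
  then have v: "v \<in> carrier_vec (dim_col A * dim_col B)"
    by (simp add: kron_mat_def)
  \<comment> \<open>The array after the first pass: \<open>B\<close> applied to the row
    \<open>k\<close> of \<open>v\<close>.\<close>
  define w where "w k j = (\<Sum>l<dim_col B. B $$ (j, l) * v $ (k * dim_col B + l))" for k j
  have "(euclid_norm (kron_mat A B *\<^sub>v v))\<^sup>2 = (\<Sum>i<dim_row A * dim_row B.
      (\<Sum>k<dim_col A. A $$ (i div dim_row B, k) * w k (i mod dim_row B))\<^sup>2)"
    unfolding euclid_norm_sq w_def using v
    by (intro sum.cong) (auto simp: kron_mat_mult_vec_index kron_mat_def[THEN arg_cong[where f = dim_row]]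
        simp del: index_mult_mat_vec)
  also have "\<dots> = (\<Sum>i<dim_row A. \<Sum>j<dim_row B. (\<Sum>k<dim_col A. A $$ (i, k) * w k j)\<^sup>2)"
    by (rule sum_div_mod)
  \<comment> \<open>With \<open>j\<close> fixed outside, the inner sum is the squared norm of
    \<open>A\<close> applied to one column of \<open>w\<close>.\<close>
  also have "\<dots> = (\<Sum>j<dim_row B. \<Sum>i<dim_row A. (\<Sum>k<dim_col A. A $$ (i, k) * w k j)\<^sup>2)"
    by (rule sum.swap)
  also have "\<dots> \<le> (\<Sum>j<dim_row B. (op_norm A)\<^sup>2 * (\<Sum>k<dim_col A. (w k j)\<^sup>2))"
    by (intro sum_mono op_norm_mult_vec_sq_le)
  also have "\<dots> = (op_norm A)\<^sup>2 * (\<Sum>k<dim_col A. \<Sum>j<dim_row B. (w k j)\<^sup>2)"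
    by (subst sum.swap) (simp add: sum_distrib_left)
  also have "\<dots> \<le> (op_norm A)\<^sup>2 * (\<Sum>k<dim_col A.
      (op_norm B)\<^sup>2 * (\<Sum>l<dim_col B. (v $ (k * dim_col B + l))\<^sup>2))"
    unfolding w_def by (intro mult_left_mono sum_mono op_norm_mult_vec_sq_le) auto
  also have "\<dots> = (op_norm A * op_norm B)\<^sup>2 *
      (\<Sum>k<dim_col A. \<Sum>l<dim_col B. (v $ (k * dim_col B + l))\<^sup>2)"
    by (simp add: sum_distrib_left power_mult_distrib mult.assoc)
  also have "(\<Sum>k<dim_col A. \<Sum>l<dim_col B. (v $ (k * dim_col B + l))\<^sup>2) = (euclid_norm v)\<^sup>2"
    using v by (subst sum_div_mod[symmetric]) (simp add: euclid_norm_sq)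
  finally have "(euclid_norm (kron_mat A B *\<^sub>v v))\<^sup>2 \<le> (op_norm A * op_norm B * euclid_norm v)\<^sup>2"
    by (simp add: power_mult_distrib)
  then show "euclid_norm (kron_mat A B *\<^sub>v v) \<le> op_norm A * op_norm B * euclid_norm v"
    by (rule power2_le_imp_le) simp
qed simp

text \<open>The elementary tensor of two vectors; such tensors are the test vectors for the lower
  bound on the norm.\<close>

definition kron_vec :: "real vec \<Rightarrow> real vec \<Rightarrow> real vec" where
  "kron_vec v w = vec (dim_vec v * dim_vec w) (\<lambda>i. v $ (i div dim_vec w) * w $ (i mod dim_vec w))"

lemma euclid_norm_kron_vec: "euclid_norm (kron_vec v w) = euclid_norm v * euclid_norm w"
proof (rule power2_eq_imp_eq)
  have "(euclid_norm (kron_vec v w))\<^sup>2 =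
      (\<Sum>i<dim_vec v * dim_vec w. (v $ (i div dim_vec w) * w $ (i mod dim_vec w))\<^sup>2)"
    by (simp add: euclid_norm_sq kron_vec_def)
  also have "\<dots> = (\<Sum>i<dim_vec v. \<Sum>j<dim_vec w. (v $ i * w $ j)\<^sup>2)"
    by (rule sum_div_mod)
  also have "\<dots> = (euclid_norm v * euclid_norm w)\<^sup>2"
    by (simp add: euclid_norm_sq power_mult_distrib sum_product)
  finally show "(euclid_norm (kron_vec v w))\<^sup>2 = (euclid_norm v * euclid_norm w)\<^sup>2" .
qed simp_all

lemma kron_mat_mult_kron_vec:
  assumes v: "v \<in> carrier_vec (dim_col A)" and w: "w \<in> carrier_vec (dim_col B)"
  shows "kron_mat A B *\<^sub>v kron_vec v w = kron_vec (A *\<^sub>v v) (B *\<^sub>v w)"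
proof (rule eq_vecI)
  fix i assume "i < dim_vec (kron_vec (A *\<^sub>v v) (B *\<^sub>v w))"
  then have i: "i < dim_row A * dim_row B"
    by (simp add: kron_vec_def)
  have "kron_vec v w \<in> carrier_vec (dim_col A * dim_col B)"
    using v w by (simp add: kron_vec_def)
  then have "(kron_mat A B *\<^sub>v kron_vec v w) $ i = (\<Sum>k<dim_col A. A $$ (i div dim_row B, k) *
      (\<Sum>l<dim_col B. B $$ (i mod dim_row B, l) * kron_vec v w $ (k * dim_col B + l)))"
    using i by (rule kron_mat_mult_vec_index)
  also have "\<dots> = (\<Sum>k<dim_col A. A $$ (i div dim_row B, k) *
      (\<Sum>l<dim_col B. B $$ (i mod dim_row B, l) * (v $ k * w $ l)))"
    using v w by (simp add: kron_vec_def mult_add_less)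
  also have "\<dots> = (\<Sum>k<dim_col A. A $$ (i div dim_row B, k) * v $ k) *
      (\<Sum>l<dim_col B. B $$ (i mod dim_row B, l) * w $ l)"
    unfolding sum_product by (simp add: sum_distrib_left mult_ac)
  also have "\<dots> = kron_vec (A *\<^sub>v v) (B *\<^sub>v w) $ i"
    using v w i div_mod_less[OF i] by (simp add: kron_vec_def scalar_prod_def atLeast0LessThan)
  finally show "(kron_mat A B *\<^sub>v kron_vec v w) $ i = kron_vec (A *\<^sub>v v) (B *\<^sub>v w) $ i" .
qed (simp add: kron_mat_def kron_vec_def)

text \<open>For the lower bound, elementary tensors are tested and the suprema over the two factors
  are taken one after the other, without choosing norm-attaining vectors.\<close>

lemma op_norm_kron_mat: "op_norm (kron_mat A B) = op_norm A * op_norm B"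
proof (rule antisym[OF op_norm_kron_mat_le])
  let ?n = "op_norm (kron_mat A B)"
  have bound: "euclid_norm (A *\<^sub>v v) * euclid_norm (B *\<^sub>v w) \<le> ?n * (euclid_norm v * euclid_norm w)"
    if v: "v \<in> carrier_vec (dim_col A)" and w: "w \<in> carrier_vec (dim_col B)" for v w
    using euclid_norm_le_op_norm[of "kron_vec v w" "kron_mat A B"] v w
    by (simp add: kron_mat_mult_kron_vec euclid_norm_kron_vec)
      (simp add: kron_vec_def kron_mat_def)
  \<comment> \<open>First supremum: \<open>w\<close> stays fixed and \<open>v\<close> varies. The
    case distinction only guards the division.\<close>
  have *: "op_norm A * euclid_norm (B *\<^sub>v w) \<le> ?n * euclid_norm w"
    if w: "w \<in> carrier_vec (dim_col B)" for w
  proof (cases "euclid_norm (B *\<^sub>v w) = 0")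
    case False
    then have pos: "0 < euclid_norm (B *\<^sub>v w)"
      using euclid_norm_nonneg[of "B *\<^sub>v w"] by linarith
    have "op_norm A \<le> ?n * euclid_norm w / euclid_norm (B *\<^sub>v w)"
    proof (rule op_norm_le)
      fix v :: "real vec" assume "v \<in> carrier_vec (dim_col A)"
      from bound[OF this w] pos
      show "euclid_norm (A *\<^sub>v v) \<le> ?n * euclid_norm w / euclid_norm (B *\<^sub>v w) * euclid_norm v"
        by (simp add: field_simps)
    qed simp
    with pos show ?thesis by (simp add: field_simps)
  qed simp
  show "op_norm A * op_norm B \<le> ?n"
  proof (cases "op_norm A = 0")
    case False
    then have pos: "0 < op_norm A"
      using op_norm_nonneg[of A] by linarith
    have "op_norm B \<le> ?n / op_norm A"
    proof (rule op_norm_le)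
      fix w :: "real vec" assume "w \<in> carrier_vec (dim_col B)"
      from *[OF this] pos show "euclid_norm (B *\<^sub>v w) \<le> ?n / op_norm A * euclid_norm w"
        by (simp add: field_simps)
    qed simp
    with pos show ?thesis by (simp add: field_simps)
  qed simp
qed

definition kron_entries ::
  "nat \<Rightarrow> nat \<Rightarrow> (nat \<times> nat \<Rightarrow> real) \<Rightarrow> (nat \<times> nat \<Rightarrow> real) \<Rightarrow> nat \<times> nat \<Rightarrow> real" where
  "kron_entries d1 d2 x y = (\<lambda>(i, j). if i < d1 * d2 \<and> j < d1 * d2
     then x (i div d2, j div d2) * y (i mod d2, j mod d2) else 0)"

section \<open>Kronecker products as an instance of the pairing\<close>

lemma kron_mat_mult:
  assumes "dim_col A = dim_row A'" "dim_col B = dim_row B'"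
  shows "kron_mat A B * kron_mat A' B' = kron_mat (A * A') (B * B')"
proof (rule eq_matI)
  fix i j
  assume "i < dim_row (kron_mat (A * A') (B * B'))" "j < dim_col (kron_mat (A * A') (B * B'))"
  then have i: "i < dim_row A * dim_row B" and j: "j < dim_col A' * dim_col B'"
    by (auto simp: kron_mat_def)
  have "(kron_mat A B * kron_mat A' B') $$ (i, j) = (\<Sum>k<dim_row A' * dim_row B'.
      A $$ (i div dim_row B, k div dim_row B') * B $$ (i mod dim_row B, k mod dim_row B') *
      (A' $$ (k div dim_row B', j div dim_col B') * B' $$ (k mod dim_row B', j mod dim_col B')))"
    using i j assms by (simp add: kron_mat_def scalar_prod_def atLeast0LessThan)
  also have "\<dots> = (\<Sum>k<dim_row A'. \<Sum>l<dim_row B'.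
      A $$ (i div dim_row B, k) * B $$ (i mod dim_row B, l) *
      (A' $$ (k, j div dim_col B') * B' $$ (l, j mod dim_col B')))"
    by (rule sum_div_mod)
  \<comment> \<open>The summand separates into a factor in \<open>k\<close> and a factor in
    \<open>l\<close>, so the double sum is a product of two matrix entries.\<close>
  also have "\<dots> = (\<Sum>k<dim_row A'. A $$ (i div dim_row B, k) * A' $$ (k, j div dim_col B')) *
      (\<Sum>l<dim_row B'. B $$ (i mod dim_row B, l) * B' $$ (l, j mod dim_col B'))"
    by (simp add: sum_product mult.assoc mult.left_commute)
  also have "\<dots> = kron_mat (A * A') (B * B') $$ (i, j)"
    using i j assms div_mod_less[OF i] div_mod_less[OF j]
    by (simp add: kron_mat_def scalar_prod_def atLeast0LessThan)
  finally show "(kron_mat A B * kron_mat A' B') $$ (i, j) = kron_mat (A * A') (B * B') $$ (i, j)" .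
qed (simp_all add: kron_mat_def)

lemma kron_mat_one: "kron_mat (1\<^sub>m m) (1\<^sub>m n) = 1\<^sub>m (m * n)"
proof (rule eq_matI)
  fix i j assume "i < dim_row (1\<^sub>m (m * n) :: real mat)" "j < dim_col (1\<^sub>m (m * n) :: real mat)"
  then have ij: "i < m * n" "j < m * n" by auto
  have "i = j \<longleftrightarrow> i div n = j div n \<and> i mod n = j mod n"
    by (metis div_mult_mod_eq)
  then show "kron_mat (1\<^sub>m m) (1\<^sub>m n) $$ (i, j) = 1\<^sub>m (m * n) $$ (i, j)"
    using ij div_mod_less[OF ij(1)] div_mod_less[OF ij(2)] by (auto simp: kron_mat_def)
qed (simp_all add: kron_mat_def)

lemma matrix_pairing_kron: "matrix_pairing d1 d2 (d1 * d2) kron_mat (kron_entries d1 d2) (*)"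
proof
  fix X Y :: "real mat" assume X: "X \<in> carrier_mat d1 d1" and Y: "Y \<in> carrier_mat d2 d2"
  then show "kron_mat X Y \<in> carrier_mat (d1 * d2) (d1 * d2)"
    by (simp add: kron_mat_def)
  show "entries (kron_mat X Y) = kron_entries d1 d2 (entries X) (entries Y)"
    using X Y by (auto simp: entries_def kron_mat_def kron_entries_def fun_eq_iff div_mod_less)
  fix X' Y' :: "real mat" assume "X' \<in> carrier_mat d1 d1" "Y' \<in> carrier_mat d2 d2"
  with X Y show "kron_mat X Y * kron_mat X' Y' = kron_mat (X * X') (Y * Y')"
    by (intro kron_mat_mult) auto
next
  fix p :: "nat \<times> nat"
  show "continuous_on UNIV (\<lambda>z. kron_entries d1 d2 (fst z) (snd z) p)"
    by (cases "fst p < d1 * d2 \<and> snd p < d1 * d2")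
      (auto simp: kron_entries_def split_beta intro!: continuous_on_mult continuous_on_fst_snd_apply)
next
  fix u v :: "nat \<Rightarrow> real" assume "u \<longlonglongrightarrow> 1" "v \<longlonglongrightarrow> 1"
  then show "(\<lambda>n. u n * v n) \<longlonglongrightarrow> 1"
    using tendsto_mult[of u 1 sequentially v 1] by simp
qed (auto simp: kron_mat_one op_norm_kron_mat real_root_mult intro: mult_mono)

section \<open>Powers and the conclusion\<close>

text \<open>Each further factor \<open>a n\<close> comes from one more Kronecker product with
  \<open>A\<close>; the induction starts at \<open>k = 1\<close> with \<open>A\<close>
  itself.\<close>

lemma ex_power:
  assumes a: "marginal_instability_rate d A a" and "k \<ge> 1"
  shows "\<exists>d C. marginal_instability_rate d C (\<lambda>n. a n ^ k) \<and> (finite A \<longrightarrow> finite C) \<and>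
    ((\<forall>M\<in>A. invertible_mat M) \<longrightarrow> (\<forall>M\<in>C. invertible_mat M))"
  using \<open>k \<ge> 1\<close>
proof (induction k rule: nat_induct_at_least)
  case base
  from a show ?case by (intro exI[of _ d] exI[of _ A]) simp
next
  case (Suc k)
  then obtain d' C where C: "marginal_instability_rate d' C (\<lambda>n. a n ^ k)"
      "finite A \<longrightarrow> finite C" "(\<forall>M\<in>A. invertible_mat M) \<longrightarrow> (\<forall>M\<in>C. invertible_mat M)"
    by blast
  show ?case
    using matrix_pairing.ex_pairing[OF matrix_pairing_kron a C(1)] C(2,3) unfolding power_Suc by blast
qed

theorem theorem1:
  fixes d1 d2 k :: nat and A B :: "real mat set" and a b :: "nat \<Rightarrow> real"
  assumes "marginal_instability_rate d1 A a"
    and "marginal_instability_rate d2 B b"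
    and "k \<ge> 1"
  shows "\<forall>s \<in> {\<lambda>n. max (a n) (b n), \<lambda>n. a n * b n, \<lambda>n. a n ^ k}.
    (\<exists>d C. marginal_instability_rate d C s) \<and>
    (finite A \<and> finite B \<longrightarrow>
      (\<exists>d C. marginal_instability_rate d C s \<and> finite C)) \<and>
    ((\<forall>M\<in>A. invertible_mat M) \<and> (\<forall>M\<in>B. invertible_mat M) \<longrightarrow>
      (\<exists>d C. marginal_instability_rate d C s \<and> (\<forall>M\<in>C. invertible_mat M))) \<and>
    (finite A \<and> finite B \<and> (\<forall>M\<in>A. invertible_mat M) \<and> (\<forall>M\<in>B. invertible_mat M) \<longrightarrow>
      (\<exists>d C. marginal_instability_rate d C s \<and> finite C \<and> (\<forall>M\<in>C. invertible_mat M)))"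
proof (intro ballI)
  fix s assume s: "s \<in> {\<lambda>n. max (a n) (b n), \<lambda>n. a n * b n, \<lambda>n. a n ^ k}"
  \<comment> \<open>A single \<open>C\<close> inheriting each property separately serves all four
    conjuncts. For the powers, \<open>ex_power\<close> gives the stronger form with conditions on
    \<open>A\<close> alone.\<close>
  have "\<exists>d C. marginal_instability_rate d C s \<and> (finite A \<and> finite B \<longrightarrow> finite C) \<and>
    ((\<forall>M\<in>A. invertible_mat M) \<and> (\<forall>M\<in>B. invertible_mat M) \<longrightarrow> (\<forall>M\<in>C. invertible_mat M))"
    using s matrix_pairing.ex_pairing[OF matrix_pairing_direct_sum assms(1,2)]
      matrix_pairing.ex_pairing[OF matrix_pairing_kron assms(1,2)] ex_power[OF assms(1,3)]
    by (elim insertE emptyE) (hypsubst, blast)+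
  then obtain d C where "marginal_instability_rate d C s" "finite A \<and> finite B \<longrightarrow> finite C"
    "(\<forall>M\<in>A. invertible_mat M) \<and> (\<forall>M\<in>B. invertible_mat M) \<longrightarrow> (\<forall>M\<in>C. invertible_mat M)"
    by blast
  then show "(\<exists>d C. marginal_instability_rate d C s) \<and>
    (finite A \<and> finite B \<longrightarrow>
      (\<exists>d C. marginal_instability_rate d C s \<and> finite C)) \<and>
    ((\<forall>M\<in>A. invertible_mat M) \<and> (\<forall>M\<in>B. invertible_mat M) \<longrightarrow>
      (\<exists>d C. marginal_instability_rate d C s \<and> (\<forall>M\<in>C. invertible_mat M))) \<and>
    (finite A \<and> finite B \<and> (\<forall>M\<in>A. invertible_mat M) \<and> (\<forall>M\<in>B. invertible_mat M) \<longrightarrow>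
      (\<exists>d C. marginal_instability_rate d C s \<and> finite C \<and> (\<forall>M\<in>C. invertible_mat M)))"
    by blast
qed

end
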